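(* For all constants $0<\beta_1\le\beta_2$ and every $\epsilon\in(0,1)$ there exist constants $C>0$ and $N_0$ such that the following holds. Let $G$ be a finite undirected graph with $N\ge N_0$ vertices and maximum degree $\Delta$ satisfying $\beta_1N\le\Delta\le\beta_2N$, let $D\ge\Delta+1$ be the number of available colours, and run the FCFL algorithm on $G$ with $b=1$ and periodic reset times $S_\tau=\tau(\Delta+1)$, $\tau=1,2,\dots$. Let $R\in\{1,2,\dots\}$ be the earliest time slot in which $G$ is properly coloured. Then $$\mathbb P(R\ge C\,N\log N)\le\epsilon .$$ That is, when $\Delta=\Theta(N)$ the convergence time is $R=\mathcal O(N\log N)$ as $N\to\infty$.
   Context: All logarithms are natural. A proper colouring of $G$ with colour set $\{1,\dots,D\}$ assigns to each vertex a colour so that adjacent vertices have different colours. Given a colour assignment, a vertex is satisfied if none of its neighbours has the same colour, and unsatisfied otherwise. FCFL (Fast Communication-Free Learning) algorithm. Parameters: a number of colours $D$, $b\in(0,1]$, and a nondecreasing sequence of reset times $S_1\le S_2\le\cdots$ in $\mathbb N=\{1,2,\dots\}$ common to all vertices. Each vertex keeps a probability vector $\mathbf p\in[0,1]^D$, initially $\mathbf p=\frac1D\mathbf 1$, and a state $m\in\{0,1\}$, initially $m=0$ ($m=1$ is called the permanent state). In each time slot $t=1,2,\dots$ all vertices simultaneously do the following: (1) if $t\in\{S_1,S_2,\dots\}$, set $m=0$; (2) select a colour $c$ at random according to the vertex's current $\mathbf p$, independently across vertices and of the past given the current vectors; (3) if $m=0$ and the vertex is satisfied under the colours selected in this slot,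 set $\mathbf p=\delta_c$ (mass one on $c$) and $m=1$; if $m=0$ and the vertex is unsatisfied, set $\mathbf p\leftarrow(1-b)\mathbf p+\frac bD\mathbf 1$; if $m=1$, change nothing (so the vertex keeps selecting the same colour). When $b=1$, an unsatisfied vertex with $m=0$ selects its next colour uniformly at random. The graph is properly coloured in slot $t$ if the colours selected in step (2) of slot $t$ form a proper colouring. *)

theory Defs
  imports "HOL-Probability.Probability"
begin

definition finite_graph :: "'v set \<Rightarrow> 'v set set \<Rightarrow> bool" where
  "finite_graph V E \<longleftrightarrow> finite V \<and> (\<forall>e\<in>E. e \<subseteq> V \<and> card e = 2)"

definition degree :: "'v set \<Rightarrow> 'v set set \<Rightarrow> 'v \<Rightarrow> nat" where
  "degree V E v = card {u\<in>V. {u, v} \<in> E}"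

definition max_degree :: "'v set \<Rightarrow> 'v set set \<Rightarrow> nat" where
  "max_degree V E = Max (degree V E ` V)"

definition satisfied :: "'v set \<Rightarrow> 'v set set \<Rightarrow> ('v \<Rightarrow> nat) \<Rightarrow> 'v \<Rightarrow> bool" where
  "satisfied V E c v \<longleftrightarrow> (\<forall>u\<in>V. {u, v} \<in> E \<longrightarrow> c u \<noteq> c v)"

definition proper_colouring :: "'v set \<Rightarrow> 'v set set \<Rightarrow> nat \<Rightarrow> ('v \<Rightarrow> nat) \<Rightarrow> bool" where
  "proper_colouring V E D c \<longleftrightarrow>
     c \<in> V \<rightarrow> {1..D} \<and> (\<forall>u\<in>V. \<forall>v\<in>V. {u, v} \<in> E \<longrightarrow> c u \<noteq> c v)"

text \<open>
  A vertex stores the vector \<open>p\<close>, as a function of the colour of which only the values on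
  \<open>{1..D}\<close> matter, and the flag \<open>m = 1\<close> as a Boolean. The reset times are
  \<open>S 1, S 2, \<dots>\<close>; the value \<open>S 0\<close> is never used.

  A run is recorded as the sequence \<open>\<omega>\<close> of the selected colourings, \<open>\<omega> n\<close> being the
  colouring selected in slot \<open>n + 1\<close>. Apart from the selections the algorithm is deterministic,
  so the state of the vertices is a function of \<open>\<omega>\<close>.
\<close>

type_synonym vertex_state = "(nat \<Rightarrow> real) \<times> bool"

definition reset :: "(nat \<Rightarrow> nat) \<Rightarrow> nat \<Rightarrow> vertex_state \<Rightarrow> vertex_state" where
  "reset S t = (\<lambda>(p, m). (p, if t \<in> S ` {1..} then False else m))"

definition learn :: "'v set \<Rightarrow> 'v set set \<Rightarrow> nat \<Rightarrow> real \<Rightarrow> ('v \<Rightarrow> nat) \<Rightarrow> 'v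
    \<Rightarrow> vertex_state \<Rightarrow> vertex_state" where
  "learn V E D b c v = (\<lambda>(p, m).
     if m then (p, m)
     else if satisfied V E c v then (\<lambda>i. if i = c v then 1 else 0, True)
     else (\<lambda>i. (1 - b) * p i + b / real D, m))"

text \<open>
  \<open>fcfl_state V E D b S \<omega> n\<close> is the state at the end of slot \<open>n\<close>; it depends on
  \<open>\<omega> 0, \<dots>, \<omega> (n - 1)\<close> only.
\<close>

primrec fcfl_state :: "'v set \<Rightarrow> 'v set set \<Rightarrow> nat \<Rightarrow> real \<Rightarrow> (nat \<Rightarrow> nat) \<Rightarrow> (nat \<Rightarrow> 'v \<Rightarrow> nat)
    \<Rightarrow> nat \<Rightarrow> 'v \<Rightarrow> vertex_state" where
  "fcfl_state V E D b S \<omega> 0 = (\<lambda>v. (\<lambda>i. 1 / real D, False))"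
| "fcfl_state V E D b S \<omega> (Suc n) =
     (\<lambda>v. learn V E D b (\<omega> n) v (reset S (Suc n) (fcfl_state V E D b S \<omega> n v)))"

definition colouring_space :: "'v set \<Rightarrow> nat \<Rightarrow> ('v \<Rightarrow> nat) measure" where
  "colouring_space V D = (\<Pi>\<^sub>M v\<in>V. count_space {1..D})"

text \<open>
  The conditional law of the colouring selected in slot \<open>n + 1\<close> given the past. Since
  \<^const>\<open>reset\<close> leaves \<open>p\<close> alone, the vectors used are those at the end of slot \<open>n\<close>.
\<close>

definition selection :: "'v set \<Rightarrow> 'v set set \<Rightarrow> nat \<Rightarrow> real \<Rightarrow> (nat \<Rightarrow> nat)
    \<Rightarrow> nat \<Rightarrow> (nat \<Rightarrow> 'v \<Rightarrow> nat) \<Rightarrow> ('v \<Rightarrow> nat) measure" where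
  "selection V E D b S n \<omega> =
     (\<Pi>\<^sub>M v\<in>V. point_measure {1..D} (\<lambda>i. ennreal (fst (fcfl_state V E D b S \<omega> n v) i)))"

text \<open>
  The law of the whole run: the Ionescu-Tulcea measure of the kernels \<^const>\<open>selection\<close>, i.e.
  the constant \<open>PF.lim\<close> of the locale \<^locale>\<open>Ionescu_Tulcea\<close>, whose assumptions are
  verified in \<open>Ionescu_Tulcea_selection\<close> below.
\<close>

definition fcfl :: "'v set \<Rightarrow> 'v set set \<Rightarrow> nat \<Rightarrow> real \<Rightarrow> (nat \<Rightarrow> nat)
    \<Rightarrow> (nat \<Rightarrow> 'v \<Rightarrow> nat) measure" where
  "fcfl V E D b S =
     projective_family.lim UNIV
       (Ionescu_Tulcea.CI (selection V E D b S) (\<lambda>_. colouring_space V D))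
       (\<lambda>_. colouring_space V D)"

text \<open>The infimum is \<open>\<infinity>\<close> if no slot yields a proper colouring.\<close>

definition convergence_time :: "'v set \<Rightarrow> 'v set set \<Rightarrow> nat \<Rightarrow> (nat \<Rightarrow> 'v \<Rightarrow> nat) \<Rightarrow> enat" where
  "convergence_time V E D \<omega> = Inf {enat (Suc n) | n. proper_colouring V E D (\<omega> n)}"

lemma sets_colouring_space:
  assumes "finite V"
  shows "colouring_space V D = count_space (V \<rightarrow>\<^sub>E {1..D})"
  unfolding colouring_space_def by (rule count_space_PiM_finite) (use assms in auto)

lemma fcfl_state_cong:
  assumes "\<And>k. k < n \<Longrightarrow> \<omega> k = \<omega>' k"
  shows "fcfl_state V E D b S \<omega> n = fcfl_state V E D b S \<omega>' n"
  using assms by (induction n) auto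

lemma fcfl_state_prob:
  assumes "D > 0" "0 \<le> b" "b \<le> 1" "v \<in> V" "\<And>k. k < n \<Longrightarrow> \<omega> k \<in> V \<rightarrow> {1..D}"
  shows "(\<forall>i. fst (fcfl_state V E D b S \<omega> n v) i \<ge> 0) \<and>
         (\<Sum>i\<in>{1..D}. fst (fcfl_state V E D b S \<omega> n v) i) = 1"
  using assms(5)
proof (induction n)
  case 0
  then show ?case using assms by simp
next
  case (Suc n)
  let ?p = "fst (fcfl_state V E D b S \<omega> n v)"
  have IH: "\<forall>i. ?p i \<ge> 0" "(\<Sum>i\<in>{1..D}. ?p i) = 1"
    using Suc by auto
  have "\<omega> n v \<in> {1..D}"
    using Suc.prems[of n] assms(4) by auto
  moreover have "(\<Sum>i\<in>{1..D}. (1 - b) * ?p i + b / real D) = 1"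
    using IH(2) assms(1) by (simp add: sum.distrib flip: sum_distrib_left)
  ultimately show ?case
    using IH assms(2,3)
    by (auto simp: learn_def reset_def split: prod.splits if_splits)
qed

lemma Ionescu_Tulcea_selection:
  assumes V: "finite V" and D: "D > 0" and b: "0 \<le> b" "b \<le> 1"
  shows "Ionescu_Tulcea (selection V E D b S) (\<lambda>_. colouring_space V D)"
proof (rule Ionescu_Tulcea.intro)
  fix n :: nat
  let ?M = "\<lambda>_::nat. colouring_space V D"
  have fin: "finite (V \<rightarrow>\<^sub>E {1..D})"
    using V by (intro finite_PiE) auto
  have PiM_eq: "PiM {0..<n} ?M = count_space ({0..<n} \<rightarrow>\<^sub>E (V \<rightarrow>\<^sub>E {1..D}))"
    unfolding sets_colouring_space[OF V]
    by (rule count_space_PiM_finite) (use fin in \<open>auto intro: countable_finite\<close>)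
  show prob: "prob_space (selection V E D b S n \<omega>)" if "\<omega> \<in> space (PiM {0..<n} ?M)" for \<omega>
  proof -
    have range: "\<omega> k \<in> V \<rightarrow> {1..D}" if "k < n" for k
      using that \<open>\<omega> \<in> _\<close> unfolding PiM_eq by (fastforce simp: PiE_iff)
    show ?thesis
      unfolding selection_def
    proof (rule prob_space_PiM)
      fix v assume "v \<in> V"
      note * = fcfl_state_prob[OF D b this, of n \<omega> E S, OF range]
      show "prob_space (point_measure {1..D} (\<lambda>i. ennreal (fst (fcfl_state V E D b S \<omega> n v) i)))"
        using * by (intro prob_space_point_measure) auto
    qed
  qed
  have sets: "sets (selection V E D b S n \<omega>) = sets (colouring_space V D)" for \<omega>
    unfolding selection_def colouring_space_def
    by (intro sets_PiM_cong) (auto simp: sets_point_measure)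
  show "selection V E D b S n \<in> PiM {0..<n} ?M \<rightarrow>\<^sub>M subprob_algebra (colouring_space V D)"
    using prob sets unfolding PiM_eq
    by (auto simp: space_subprob_algebra intro: prob_space_imp_subprob_space)
qed

lemma sets_fcfl:
  assumes "finite V" "D > 0" "0 \<le> b" "b \<le> 1"
  shows "sets (fcfl V E D b S) = sets (\<Pi>\<^sub>M n\<in>UNIV. colouring_space V D)"
proof -
  interpret Ionescu_Tulcea "selection V E D b S" "\<lambda>_. colouring_space V D"
    by (rule Ionescu_Tulcea_selection) (use assms in auto)
  show ?thesis unfolding fcfl_def by (rule PF.sets_lim)
qed

lemma prob_space_fcfl:
  assumes "finite V" "D > 0" "0 \<le> b" "b \<le> 1"
  shows "prob_space (fcfl V E D b S)"
proof -
  interpret Ionescu_Tulcea "selection V E D b S" "\<lambda>_. colouring_space V D"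
    by (rule Ionescu_Tulcea_selection) (use assms in auto)
  have "prob_space (CI {})"
    by (rule PF.prob_space_P) auto
  then have "prob_space (distr PF.lim (PiM {} (\<lambda>_. colouring_space V D)) (\<lambda>x. restrict x {}))"
    by (subst distr_lim) auto
  then show ?thesis
    unfolding fcfl_def
    by (rule prob_space_distrD[rotated])
       (simp add: measurable_cong_sets[OF PF.sets_lim refl] measurable_restrict_subset)
qed

lemma measurable_convergence_time:
  assumes "finite V" "D > 0" "0 \<le> b" "b \<le> 1"
  shows "convergence_time V E D \<in> fcfl V E D b S \<rightarrow>\<^sub>M count_space UNIV"
proof -
  let ?M = "\<Pi>\<^sub>M n\<in>(UNIV :: nat set). colouring_space V D"
  have [measurable]: "Measurable.pred ?M (\<lambda>\<omega>. proper_colouring V E D (\<omega> n))" for n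
  proof -
    have "Measurable.pred (colouring_space V D) (proper_colouring V E D)"
      unfolding sets_colouring_space[OF assms(1)] by simp
    then show ?thesis
      by (rule measurable_compose[rotated]) simp
  qed
  have "convergence_time V E D =
      (\<lambda>\<omega>. INF n. if proper_colouring V E D (\<omega> n) then enat (Suc n) else \<infinity>)"
    unfolding convergence_time_def
    by (intro ext antisym Inf_greatest INF_greatest)
       (auto intro!: Inf_lower INF_lower2 split: if_splits)
  also have "\<dots> \<in> ?M \<rightarrow>\<^sub>M count_space UNIV"
    by measurable
  finally show ?thesis
    by (subst measurable_cong_sets[OF sets_fcfl[OF assms] refl])
qed

end

theory Submission
  imports Defs
begin

text \<open>
  Let \<open>X\<close> be the number of vertices that are not permanent, \<open>\<Delta>\<close> the maximum degree and
  \<open>d = \<Delta> + 1\<close>. A vertex that is not permanent selects uniformly, so it has the colour of a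
  given neighbour with probability \<open>1/D\<close>. By the union bound over neighbours a slot without
  reset maps the expectation of \<open>X\<close> to at most \<open>(\<Delta>/D) X\<close>. In a reset slot the permanent
  vertices are at risk too, but two of them never collide with each other, and counting colliding
  edges from the side of the non-permanent end shows that they contribute at most
  \<open>(\<Delta>/D) X\<close> again. A period of \<open>d\<close> slots containing one reset thus contributes a factor
  \<open>2 (\<Delta>/D)\<^sup>d \<le> 2 (1 - 1/d)\<^sup>d \<le> 2/e < 1\<close>, so \<open>O(log N)\<close> periods make the
  expectation of \<open>X\<close> small, and \<open>X = 0\<close> forces a proper colouring.
\<close>

section \<open>Independent colour choices: collisions and supports\<close>

lemma emeasure_PiM_point_measure_collision:
  assumes A: "finite A" and prob: "\<And>v. v \<in> V \<Longrightarrow> sum (p v) A = 1"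
    and uv: "u \<in> V" "v \<in> V" "u \<noteq> v"
  shows "emeasure (\<Pi>\<^sub>M v\<in>V. point_measure A (p v)) {x \<in> V \<rightarrow>\<^sub>E A. x u = x v} = (\<Sum>i\<in>A. p u i * p v i)"
proof -
  let ?P = "\<lambda>v. point_measure A (p v)"
  \<comment> \<open>The cylinder where \<open>u\<close> and \<open>v\<close> both select
    \<open>i\<close>. These are disjoint in \<open>i\<close>, and \<open>u \<noteq> v\<close> makes
    each measure a product.\<close>
  let ?B = "\<lambda>i. prod_emb V ?P {u, v} (Pi\<^sub>E {u, v} (\<lambda>_. {i}))"
  have B: "x \<in> ?B i \<longleftrightarrow> x \<in> V \<rightarrow>\<^sub>E A \<and> x u = i \<and> x v = i" for x i
    unfolding prod_emb_def Int_iff vimage_eq restrict_PiE_iff by (auto simp: space_point_measure)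
  have "{x \<in> V \<rightarrow>\<^sub>E A. x u = x v} = (\<Union>i\<in>A. ?B i)"
    unfolding set_eq_iff UN_iff B using uv by auto
  moreover have "(\<Sum>i\<in>A. emeasure (PiM V ?P) (?B i)) = emeasure (PiM V ?P) (\<Union>i\<in>A. ?B i)"
  proof (rule sum_emeasure)
    show "?B ` A \<subseteq> sets (PiM V ?P)"
      by (intro image_subsetI sets_PiM_I) (use uv in \<open>auto simp: sets_point_measure\<close>)
    show "disjoint_family_on ?B A"
      unfolding disjoint_family_on_def set_eq_iff Int_iff B by auto
  qed fact
  moreover have "emeasure (PiM V ?P) (?B i) = p u i * p v i" if "i \<in> A" for i
  proof -
    have "emeasure (PiM V ?P) (?B i) = (\<Prod>w\<in>{u, v}. emeasure (?P w) {i})"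
      using uv prob that
      by (intro emeasure_PiM_emb) (auto intro!: prob_space_point_measure A simp: sets_point_measure)
    also have "\<dots> = p u i * p v i"
      using uv that A by (simp add: emeasure_point_measure_finite)
    finally show ?thesis .
  qed
  ultimately show ?thesis by simp
qed

lemma AE_PiM_point_measure_support:
  assumes "finite V" "finite A" and prob: "\<And>v. v \<in> V \<Longrightarrow> sum (p v) A = 1"
  shows "AE x in (\<Pi>\<^sub>M v\<in>V. point_measure A (p v)). \<forall>v\<in>V. x v \<in> A \<and> p v (x v) > 0"
proof (intro AE_finite_allI assms)
  fix v assume v: "v \<in> V"
  show "AE x in (\<Pi>\<^sub>M v\<in>V. point_measure A (p v)). x v \<in> A \<and> p v (x v) > 0"
    by (rule AE_PiM_component[OF _ v])
      (auto intro!: prob_space_point_measure prob assms simp: AE_point_measure)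
qed

section \<open>Consistent states and the potential\<close>

definition unlocked :: "'v set \<Rightarrow> ('v \<Rightarrow> vertex_state) \<Rightarrow> 'v set" where
  "unlocked V s = {v \<in> V. \<not> snd (s v)}"

text \<open>Invariant for \<open>b = 1\<close> at the end of a slot, \<open>c\<close> being the
  colouring just selected. A reset clears the flag and leaves a point mass, but within the same slot
  the vertex becomes permanent again or, as \<open>b = 1\<close>, returns to the uniform
  vector.\<close>

definition consistent :: "'v set \<Rightarrow> 'v set set \<Rightarrow> nat \<Rightarrow> ('v \<Rightarrow> nat) \<Rightarrow> ('v \<Rightarrow> vertex_state) \<Rightarrow> bool" where
  "consistent V E D c s \<longleftrightarrow>
     (\<forall>v\<in>V. s v = (\<lambda>i. 1 / real D, False) \<or>
            c v \<in> {1..D} \<and> s v = (\<lambda>i. if i = c v then 1 else 0, True)) \<and>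
     (\<forall>u\<in>V. \<forall>v\<in>V. {u, v} \<in> E \<longrightarrow> snd (s u) \<longrightarrow> snd (s v) \<longrightarrow> c u \<noteq> c v)"

text \<open>
  A permanent vertex selects its own colour only almost surely. The value \<open>\<top>\<close> makes a bound on
  the expected potential cover the null set of inconsistent states as well.
\<close>

definition potential :: "'v set \<Rightarrow> 'v set set \<Rightarrow> nat \<Rightarrow> ('v \<Rightarrow> nat) \<Rightarrow> ('v \<Rightarrow> vertex_state) \<Rightarrow> ennreal" where
  "potential V E D c s = (if consistent V E D c s then of_nat (card (unlocked V s)) else \<top>)"

definition slot :: "'v set \<Rightarrow> 'v set set \<Rightarrow> nat \<Rightarrow> (nat \<Rightarrow> nat) \<Rightarrow> nat \<Rightarrow> ('v \<Rightarrow> nat)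
    \<Rightarrow> ('v \<Rightarrow> vertex_state) \<Rightarrow> 'v \<Rightarrow> vertex_state" where
  "slot V E D S t x s v = learn V E D 1 x v (reset S t (s v))"

lemma consistent_imp_proper_colouring:
  assumes "consistent V E D c s" "unlocked V s = {}"
  shows "proper_colouring V E D c"
  using assms unfolding consistent_def proper_colouring_def unlocked_def by fastforce

lemma consistent_cases:
  assumes "consistent V E D c s" "v \<in> V"
  obtains "v \<in> unlocked V s" "s v = (\<lambda>i. 1 / real D, False)"
  | "v \<notin> unlocked V s" "c v \<in> {1..D}" "s v = (\<lambda>i. if i = c v then 1 else 0, True)"
  using assms unfolding consistent_def unlocked_def by force

lemma consistent_sum:
  assumes "consistent V E D c s" "D > 0" "v \<in> V"
  shows "(\<Sum>i\<in>{1..D}. ennreal (fst (s v) i)) = 1"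
  using assms(1,3)
proof (cases rule: consistent_cases)
  case 1
  have "(\<Sum>i\<in>{1..D}. ennreal (fst (s v) i)) = ennreal (\<Sum>i\<in>{1..D}. 1 / real D)"
    unfolding 1 by (subst sum_ennreal[symmetric]) auto
  then show ?thesis using assms by simp
next
  case 2
  then show ?thesis by (simp add: if_distrib[of ennreal] cong: if_cong)
qed

text \<open>On the support of the selection a permanent vertex repeats its colour. If both ends of
  an edge are permanent after the slot, then either one was satisfied in it, or both were permanent
  before and keep colours that already differed.\<close>

lemma consistent_slot:
  assumes cons: "consistent V E D c s"
    and x: "\<forall>v\<in>V. x v \<in> {1..D} \<and> ennreal (fst (s v) (x v)) > 0"
  shows "consistent V E D x (slot V E D S t x s)"
proof -
  have locked: "x v = c v" if "v \<in> V" "snd (s v)" for v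
    using cons that(1) by (cases rule: consistent_cases) (use x that in \<open>auto split: if_splits\<close>)
  show ?thesis
    unfolding consistent_def
  proof (intro conjI ballI impI)
    fix v assume v: "v \<in> V"
    show "slot V E D S t x s v = (\<lambda>i. 1 / real D, False) \<or> x v \<in> {1..D} \<and>
        slot V E D S t x s v = (\<lambda>i. if i = x v then 1 else 0, True)"
      using cons v
      by (cases rule: consistent_cases) (use x v locked[OF v] in \<open>auto simp: slot_def learn_def reset_def\<close>)
  next
    fix u v assume uv: "u \<in> V" "v \<in> V" "{u, v} \<in> E"
      and s: "snd (slot V E D S t x s u)" "snd (slot V E D S t x s v)"
    have vu: "{v, u} \<in> E" using uv(3) by (simp add: insert_commute)
    have "snd (s w) \<and> t \<notin> S ` {1..} \<or> satisfied V E x w" if "snd (slot V E D S t x s w)" for w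
      using that by (auto simp: slot_def learn_def reset_def split: prod.splits if_splits)
    note this[OF s(1)] this[OF s(2)]
    moreover have "c u \<noteq> c v" if "snd (s u)" "snd (s v)"
      using cons uv that unfolding consistent_def by blast
    ultimately show "x u \<noteq> x v"
      using locked uv vu by (auto simp: satisfied_def)
  qed
qed

lemma unlocked_slot:
  "unlocked V (slot V E D S t x s) =
    {v \<in> (if t \<in> S ` {1..} then V else unlocked V s). \<not> satisfied V E x v}"
proof (rule set_eqI)
  fix v
  show "v \<in> unlocked V (slot V E D S t x s) \<longleftrightarrow>
      v \<in> {v \<in> (if t \<in> S ` {1..} then V else unlocked V s). \<not> satisfied V E x v}"
    by (cases "s v") (auto simp: unlocked_def slot_def learn_def reset_def)
qed

text \<open>The sum is the collision probability along an edge. A uniform end contributes the factor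
  \<open>1 / real D\<close> and the other vector has mass one; two permanent ends have point masses
  at different colours, so every product vanishes.\<close>

lemma collision_sum_le:
  assumes cons: "consistent V E D c s" and D: "D > 0" and uv: "u \<in> V" "v \<in> V" "{u, v} \<in> E"
  shows "(\<Sum>i\<in>{1..D}. ennreal (fst (s u) i) * ennreal (fst (s v) i))
    \<le> (if u \<in> unlocked V s \<or> v \<in> unlocked V s then ennreal (1 / real D) else 0)"
proof -
  have s1: "(\<Sum>i\<in>{1..D}. ennreal (fst (s w) i)) = 1" if "w \<in> V" for w
    using consistent_sum[OF cons D that] .
  consider "u \<in> unlocked V s" | "v \<in> unlocked V s" | "u \<notin> unlocked V s" "v \<notin> unlocked V s" by blast
  then show ?thesis
  proof cases
    case 1
    with cons have "fst (s u) = (\<lambda>i. 1 / real D)"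
      by (auto elim: consistent_cases[OF _ uv(1)])
    with 1 s1[OF uv(2)] show ?thesis by (simp flip: sum_distrib_left)
  next
    case 2
    with cons have "fst (s v) = (\<lambda>i. 1 / real D)"
      by (auto elim: consistent_cases[OF _ uv(2)])
    with 2 s1[OF uv(1)] show ?thesis by (simp flip: sum_distrib_right)
  next
    case 3
    have "fst (s u) = (\<lambda>i. if i = c u then 1 else 0)" "fst (s v) = (\<lambda>i. if i = c v then 1 else 0)"
      using cons 3 by (auto elim: consistent_cases[OF _ uv(1)] consistent_cases[OF _ uv(2)])
    moreover have "c u \<noteq> c v"
      using cons uv 3 unfolding consistent_def unlocked_def by blast
    ultimately have "(\<Sum>i\<in>{1..D}. ennreal (fst (s u) i) * ennreal (fst (s v) i)) = 0"
      by (auto intro!: sum.neutral)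
    with 3 show ?thesis by simp
  qed
qed

section \<open>Counting collisions and the one-slot estimate\<close>

lemma degree_le_max_degree: "finite V \<Longrightarrow> v \<in> V \<Longrightarrow> degree V E v \<le> max_degree V E"
  unfolding max_degree_def by (intro Max_ge) auto

lemma sum_degree_le:
  assumes "finite V" "U \<subseteq> V"
  shows "(\<Sum>v\<in>U. \<Sum>u\<in>{u \<in> V. {u, v} \<in> E}. a) \<le> of_nat (card U) * (of_nat (max_degree V E) * (a :: ennreal))"
proof -
  have "(\<Sum>v\<in>U. \<Sum>u\<in>{u \<in> V. {u, v} \<in> E}. a) \<le> (\<Sum>v\<in>U. of_nat (max_degree V E) * a)"
    using assms degree_le_max_degree[of V _ E]
    by (intro sum_mono) (auto simp: degree_def intro!: mult_right_mono of_nat_mono)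
  then show ?thesis by simp
qed

text \<open>Source of the factor 2 of a reset slot: the disjunction is split into its two ends, and
  swapping the sums turns one part into the other because \<open>{u, v}\<close> is
  symmetric.\<close>

lemma sum_collisions_le:
  assumes fin: "finite V" and U: "U \<subseteq> V"
  shows "(\<Sum>v\<in>V. \<Sum>u\<in>{u \<in> V. {u, v} \<in> E}. if u \<in> U \<or> v \<in> U then a else 0)
    \<le> 2 * (of_nat (card U) * (of_nat (max_degree V E) * (a :: ennreal)))" (is "?L \<le> _")
proof -
  let ?T = "\<Sum>v\<in>U. \<Sum>u\<in>{u \<in> V. {u, v} \<in> E}. a"
  have restr: "(\<Sum>v\<in>V. \<Sum>u\<in>{u \<in> V. {u, v} \<in> E}. if v \<in> U then a else 0) = ?T"
    using fin U by (intro sum.mono_neutral_cong_right) auto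
  have "?L \<le> (\<Sum>v\<in>V. \<Sum>u\<in>{u \<in> V. {u, v} \<in> E}. (if v \<in> U then a else 0) + (if u \<in> U then a else 0))"
    by (intro sum_mono) auto
  also have "\<dots> = ?T + (\<Sum>v\<in>V. \<Sum>u\<in>{u \<in> V. {u, v} \<in> E}. if u \<in> U then a else 0)"
    by (simp only: sum.distrib restr)
  also have "(\<Sum>v\<in>V. \<Sum>u\<in>{u \<in> V. {u, v} \<in> E}. if u \<in> U then a else 0) =
      (\<Sum>u\<in>V. \<Sum>v\<in>{v \<in> V. {u, v} \<in> E}. if u \<in> U then a else 0)"
    by (rule sum.swap_restrict[OF fin fin])
  also have "\<dots> = ?T"
    unfolding restr[symmetric] by (simp add: insert_commute)
  also have "?T + ?T \<le> 2 * (of_nat (card U) * (of_nat (max_degree V E) * a))"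
    unfolding mult_2 by (intro add_mono sum_degree_le fin U)
  finally show ?thesis .
qed

text \<open>The state \<open>s\<close> and the colouring \<open>c\<close> are arbitrary, so the
  estimate applies conditionally on any history.\<close>

lemma nn_integral_potential_slot:
  assumes G: "finite_graph V E" and D: "D > 0" and \<Delta>: "max_degree V E > 0"
  shows "(\<integral>\<^sup>+x. potential V E D x (slot V E D S t x s)
      \<partial>(\<Pi>\<^sub>M v\<in>V. point_measure {1..D} (\<lambda>i. ennreal (fst (s v) i))))
    \<le> ennreal (real (max_degree V E) / real D * (if t \<in> S ` {1..} then 2 else 1)) * potential V E D c s"
    (is "(\<integral>\<^sup>+x. _ \<partial>?M) \<le> ennreal ?k * _")
proof (cases "consistent V E D c s")
  case False
  \<comment> \<open>As \<open>0 * \<top> = 0\<close> in \<open>ennreal\<close>, the factor must be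
    nonzero; this is where a positive maximum degree enters.\<close>
  have "ennreal ?k * \<top> = \<top>" using D \<Delta> by (auto simp: ennreal_mult_eq_top_iff)
  with False show ?thesis by (simp only: potential_def if_False top_greatest)
next
  case cons: True
  let ?U = "unlocked V s" and ?a = "ennreal (1 / real D)"
  \<comment> \<open>The vertices that may be non-permanent after the slot: a reset exposes the
    permanent ones as well.\<close>
  let ?W = "if t \<in> S ` {1..} then V else ?U"
  let ?nb = "\<lambda>v. {u \<in> V. {u, v} \<in> E}"
  let ?coll = "\<lambda>u v. {x \<in> V \<rightarrow>\<^sub>E {1..D}. x u = x v}"
  have fin: "finite V" and E: "\<And>u v. {u, v} \<in> E \<Longrightarrow> u \<noteq> v"
    using G by (force simp: finite_graph_def)+
  have UV: "?U \<subseteq> V" and WV: "?W \<subseteq> V" by (auto simp: unlocked_def)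
  have finW: "finite ?W" using finite_subset[OF WV fin] .
  have space: "space ?M = V \<rightarrow>\<^sub>E {1..D}"
    by (simp add: space_PiM space_point_measure)
  have sets: "?coll u v \<in> sets ?M" for u v
  proof -
    have "sets ?M = sets (colouring_space V D)"
      unfolding colouring_space_def by (intro sets_PiM_cong) (auto simp: sets_point_measure)
    then show ?thesis by (auto simp: sets_colouring_space[OF fin])
  qed
  have supp: "AE x in ?M. \<forall>v\<in>V. x v \<in> {1..D} \<and> ennreal (fst (s v) (x v)) > 0"
    by (intro AE_PiM_point_measure_support consistent_sum[OF cons D] fin) auto
  \<comment> \<open>Every unsatisfied vertex shares its colour with some neighbour, so the
    collisions seen from \<open>?W\<close> dominate the potential.\<close>
  have "AE x in ?M. potential V E D x (slot V E D S t x s)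
      \<le> (\<Sum>v\<in>?W. \<Sum>u\<in>?nb v. indicator (?coll u v) x)"
    using supp AE_space
  proof eventually_elim
    case (elim x)
    from elim(1) have "potential V E D x (slot V E D S t x s) =
        of_nat (card {v \<in> ?W. \<not> satisfied V E x v})"
      by (simp only: potential_def consistent_slot[OF cons] if_True unlocked_slot)
    also have "\<dots> = (\<Sum>v\<in>{v \<in> ?W. \<not> satisfied V E x v}. 1)"
      by simp
    also have "\<dots> = (\<Sum>v\<in>?W. if satisfied V E x v then 0 else 1)"
      by (rule sum.mono_neutral_cong_left[OF finW]) auto
    also have "\<dots> \<le> (\<Sum>v\<in>?W. \<Sum>u\<in>?nb v. indicator (?coll u v) x)"
    proof (rule sum_mono)
      fix v assume "v \<in> ?W"
      show "(if satisfied V E x v then 0 else 1) \<le> (\<Sum>u\<in>?nb v. indicator (?coll u v) x :: ennreal)"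
      proof (cases "satisfied V E x v")
        case False
        then obtain u where u: "u \<in> ?nb v" "x u = x v" by (auto simp: satisfied_def)
        then have "(1 :: ennreal) = indicator (?coll u v) x"
          using elim(2) space by simp
        also have "\<dots> \<le> (\<Sum>u\<in>?nb v. indicator (?coll u v) x)"
          using fin u(1) by (intro member_le_sum) auto
        finally show ?thesis using False by simp
      qed simp
    qed
    finally show ?case .
  qed
  then have "(\<integral>\<^sup>+x. potential V E D x (slot V E D S t x s) \<partial>?M) \<le>
      (\<integral>\<^sup>+x. (\<Sum>v\<in>?W. \<Sum>u\<in>?nb v. indicator (?coll u v) x) \<partial>?M)"
    by (rule nn_integral_mono_AE)
  also have "\<dots> = (\<Sum>v\<in>?W. \<Sum>u\<in>?nb v. emeasure ?M (?coll u v))"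
    using sets by (simp add: nn_integral_sum)
  also have "\<dots> \<le> (\<Sum>v\<in>?W. \<Sum>u\<in>?nb v. if u \<in> ?U \<or> v \<in> ?U then ?a else 0)"
  proof (intro sum_mono)
    fix v u assume v: "v \<in> ?W" and u: "u \<in> ?nb v"
    with WV have uv: "u \<in> V" "v \<in> V" "{u, v} \<in> E" by auto
    have "emeasure ?M (?coll u v) =
        (\<Sum>i\<in>{1..D}. ennreal (fst (s u) i) * ennreal (fst (s v) i))"
      using uv E by (intro emeasure_PiM_point_measure_collision consistent_sum[OF cons D]) auto
    also have "\<dots> \<le> (if u \<in> ?U \<or> v \<in> ?U then ?a else 0)"
      by (rule collision_sum_le[OF cons D uv])
    finally show "emeasure ?M (?coll u v) \<le> (if u \<in> ?U \<or> v \<in> ?U then ?a else 0)" .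
  qed
  also have "\<dots> \<le> (if t \<in> S ` {1..} then 2 else 1) * (of_nat (card ?U) * (of_nat (max_degree V E) * ?a))"
    using sum_collisions_le[OF fin UV, where E = E and a = ?a] sum_degree_le[OF fin UV, where E = E and a = ?a] by simp
  also have "\<dots> = ennreal ?k * potential V E D c s"
    using cons D by (simp add: potential_def ennreal_of_nat_eq_real_of_nat field_simps flip: ennreal_mult
      ennreal_numeral)
  finally show ?thesis .
qed

section \<open>Finite histories and the iterated estimate\<close>

lemma PiM_colouring_space:
  assumes "finite V" "finite I"
  shows "PiM I (\<lambda>_. colouring_space V D) = count_space (I \<rightarrow>\<^sub>E (V \<rightarrow>\<^sub>E {1..D}))"
proof -
  have "finite (V \<rightarrow>\<^sub>E {1..D})"
    using assms by (intro finite_PiE) auto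
  then show ?thesis
    unfolding sets_colouring_space[OF assms(1)]
    by (intro count_space_PiM_finite assms countable_finite)
qed

text \<open>The joint law of the colourings selected in the first \<open>n\<close> slots.\<close>

definition history :: "'v set \<Rightarrow> 'v set set \<Rightarrow> nat \<Rightarrow> (nat \<Rightarrow> nat) \<Rightarrow> nat \<Rightarrow> (nat \<Rightarrow> 'v \<Rightarrow> nat) measure" where
  "history V E D S n =
     Ionescu_Tulcea.C (selection V E D 1 S) (\<lambda>_. colouring_space V D) 0 n (\<lambda>_. undefined)"

text \<open>After slot \<open>n\<close> the colouring last selected is
  \<open>\<omega> (n - 1)\<close>. For \<open>n = 0\<close> the truncated index is harmless: no
  vertex is permanent, so consistency does not depend on the colouring.\<close>

definition run_potential :: "'v set \<Rightarrow> 'v set set \<Rightarrow> nat \<Rightarrow> (nat \<Rightarrow> nat) \<Rightarrow> nat \<Rightarrow> (nat \<Rightarrow> 'v \<Rightarrow> nat) \<Rightarrow> ennreal" where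
  "run_potential V E D S n \<omega> = potential V E D (\<omega> (n - 1)) (fcfl_state V E D 1 S \<omega> n)"

lemma sets_history:
  assumes "finite V" "D > 0"
  shows "sets (history V E D S n) = sets (PiM {0..<n} (\<lambda>_. colouring_space V D))"
proof -
  interpret Ionescu_Tulcea "selection V E D 1 S" "\<lambda>_. colouring_space V D"
    by (rule Ionescu_Tulcea_selection) (use assms in auto)
  show ?thesis
    unfolding history_def by (subst sets_C) auto
qed

text \<open>Tower property: slot \<open>n + 1\<close> is integrated out given the first
  \<open>n\<close> slots. Any \<open>f\<close> is admissible because the finite product spaces are
  discrete.\<close>

lemma nn_integral_history_Suc:
  assumes "finite V" "D > 0"
  shows "(\<integral>\<^sup>+\<omega>. f \<omega> \<partial>history V E D S (Suc n)) =
    (\<integral>\<^sup>+\<omega>. (\<integral>\<^sup>+x. f (fun_upd \<omega> n x) \<partial>selection V E D 1 S n \<omega>) \<partial>history V E D S n)"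
proof -
  interpret Ionescu_Tulcea "selection V E D 1 S" "\<lambda>_. colouring_space V D"
    by (rule Ionescu_Tulcea_selection) (use assms in auto)
  have f: "f \<in> borel_measurable (PiM {0..<Suc n} (\<lambda>_. colouring_space V D))"
    by (simp add: PiM_colouring_space assms)
  have eP: "eP n \<in> history V E D S n \<rightarrow>\<^sub>M subprob_algebra (PiM {0..<Suc n} (\<lambda>_. colouring_space V D))"
    by (subst measurable_cong_sets[OF sets_history[OF assms] refl]) simp
  have "(\<integral>\<^sup>+\<omega>. f \<omega> \<partial>history V E D S (Suc n)) = (\<integral>\<^sup>+\<omega>. f \<omega> \<partial>(history V E D S n \<bind> eP n))"
    by (simp add: history_def)
  also have "\<dots> = (\<integral>\<^sup>+\<omega>. (\<integral>\<^sup>+x. f x \<partial>eP n \<omega>) \<partial>history V E D S n)"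
    by (rule nn_integral_bind[OF f eP])
  also have "\<dots> = (\<integral>\<^sup>+\<omega>. (\<integral>\<^sup>+x. f (fun_upd \<omega> n x) \<partial>selection V E D 1 S n \<omega>) \<partial>history V E D S n)"
    by (intro nn_integral_cong nn_integral_eP f)
      (simp add: sets_eq_imp_space_eq[OF sets_history[OF assms]])
  finally show ?thesis .
qed

text \<open>Transfers events determined by the first \<open>n\<close> slots from the infinite run to
  \<open>history\<close>.\<close>

lemma emeasure_fcfl_cylinder:
  assumes "finite V" "D > 0" and B: "B \<in> sets (PiM {0..<n} (\<lambda>_. colouring_space V D))"
  shows "emeasure (fcfl V E D 1 S) (prod_emb UNIV (\<lambda>_. colouring_space V D) {0..<n} B) =
    emeasure (history V E D S n) B"
proof -
  interpret Ionescu_Tulcea "selection V E D 1 S" "\<lambda>_. colouring_space V D"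
    by (rule Ionescu_Tulcea_selection) (use assms in auto)
  have "prod_emb {0..<n} (\<lambda>_. colouring_space V D) {0..<n} B = B"
    using sets.sets_into_space[OF B] by (rule prod_emb_id[unfolded space_PiM[symmetric]])
  then show ?thesis
    unfolding fcfl_def history_def
    by (subst lim) (auto simp: B emeasure_CI[OF subset_refl B])
qed

text \<open>The tower property yields one factor per slot; the initial value is
  \<open>card V\<close>, since no vertex starts permanent.\<close>

lemma nn_integral_run_potential:
  assumes G: "finite_graph V E" and D: "D > 0" and \<Delta>: "max_degree V E > 0"
  shows "(\<integral>\<^sup>+\<omega>. run_potential V E D S n \<omega> \<partial>history V E D S n) \<le>
    ennreal ((\<Prod>t\<in>{1..n}. real (max_degree V E) / real D * (if t \<in> S ` {1..} then 2 else 1)) * real (card V))"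
proof (induction n)
  case 0
  interpret Ionescu_Tulcea "selection V E D 1 S" "\<lambda>_. colouring_space V D"
    by (rule Ionescu_Tulcea_selection) (use G D in \<open>auto simp: finite_graph_def\<close>)
  interpret h: prob_space "history V E D S 0"
    unfolding history_def by (rule prob_space_C) simp
  have "potential V E D c (\<lambda>v. (\<lambda>i. 1 / real D, False)) = of_nat (card V)" for c
    by (simp add: potential_def consistent_def unlocked_def)
  then show ?case
    by (simp add: run_potential_def h.emeasure_space_1 flip: ennreal_of_nat_eq_real_of_nat)
next
  case (Suc n)
  let ?k = "\<lambda>t. real (max_degree V E) / real D * (if t \<in> S ` {1..} then 2 else 1)"
  have fin: "finite V" using G by (simp add: finite_graph_def)
  have meas: "run_potential V E D S n \<in> borel_measurable (history V E D S n)"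
    by (subst measurable_cong_sets[OF sets_history[OF fin D] refl]) (simp add: PiM_colouring_space fin)
  have "(\<integral>\<^sup>+\<omega>. run_potential V E D S (Suc n) \<omega> \<partial>history V E D S (Suc n)) =
      (\<integral>\<^sup>+\<omega>. (\<integral>\<^sup>+x. run_potential V E D S (Suc n) (fun_upd \<omega> n x) \<partial>selection V E D 1 S n \<omega>) \<partial>history V E D S n)"
    by (rule nn_integral_history_Suc[OF fin D])
  also have "\<dots> \<le> (\<integral>\<^sup>+\<omega>. ennreal (?k (Suc n)) * run_potential V E D S n \<omega> \<partial>history V E D S n)"
  proof (rule nn_integral_mono)
    fix \<omega>
    have "fcfl_state V E D 1 S (fun_upd \<omega> n x) n = fcfl_state V E D 1 S \<omega> n" for x
      by (rule fcfl_state_cong) auto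
    then have "run_potential V E D S (Suc n) (fun_upd \<omega> n x) =
        potential V E D x (slot V E D S (Suc n) x (fcfl_state V E D 1 S \<omega> n))" for x
      by (simp add: run_potential_def slot_def[abs_def])
    then show "(\<integral>\<^sup>+x. run_potential V E D S (Suc n) (fun_upd \<omega> n x) \<partial>selection V E D 1 S n \<omega>) \<le>
        ennreal (?k (Suc n)) * run_potential V E D S n \<omega>"
      using nn_integral_potential_slot[OF G D \<Delta>, where S = S and t = "Suc n"
        and s = "fcfl_state V E D 1 S \<omega> n" and c = "\<omega> (n - 1)"]
      unfolding selection_def by (simp only: run_potential_def)
  qed
  also have "\<dots> = ennreal (?k (Suc n)) * (\<integral>\<^sup>+\<omega>. run_potential V E D S n \<omega> \<partial>history V E D S n)"
    by (rule nn_integral_cmult[OF meas])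
  also have "\<dots> \<le> ennreal (?k (Suc n)) * ennreal (prod ?k {1..n} * real (card V))"
    by (intro mult_left_mono Suc.IH) simp
  also have "\<dots> = ennreal (?k (Suc n) * (prod ?k {1..n} * real (card V)))"
    by (intro ennreal_mult[symmetric]) (auto intro!: mult_nonneg_nonneg prod_nonneg)
  also have "?k (Suc n) * (prod ?k {1..n} * real (card V)) = prod ?k {1..Suc n} * real (card V)"
    by (simp add: mult_ac)
  finally show ?case .
qed

text \<open>Markov's inequality at level 1. A potential below 1 after slot \<open>n\<close> is
  finite and integral, hence 0, and then slot \<open>n\<close> is properly coloured; so runs with
  convergence time at least \<open>T > n\<close> lie in the cylinder over \<open>B\<close>.\<close>

lemma prob_convergence_time_le:
  assumes G: "finite_graph V E" and D: "D > 0" and \<Delta>: "max_degree V E > 0" and n: "n > 0"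
    and T: "real n < T"
  shows "\<P>(\<omega> in fcfl V E D 1 S. ereal_of_enat (convergence_time V E D \<omega>) \<ge> ereal T) \<le>
    (\<Prod>t\<in>{1..n}. real (max_degree V E) / real D * (if t \<in> S ` {1..} then 2 else 1)) * real (card V)"
    (is "?P \<le> ?b")
proof -
  let ?M = "\<lambda>_::nat. colouring_space V D"
  have fin: "finite V" using G by (simp add: finite_graph_def)
  interpret prob_space "fcfl V E D 1 S"
    by (rule prob_space_fcfl) (use fin D in auto)
  define B where "B = {\<omega> \<in> space (PiM {0..<n} ?M). 1 \<le> run_potential V E D S n \<omega>}"
  have B: "B \<in> sets (PiM {0..<n} ?M)"
    by (simp add: B_def PiM_colouring_space fin)
  have emb: "prod_emb UNIV ?M {0..<n} B \<in> sets (fcfl V E D 1 S)"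
    using B by (subst sets_fcfl) (auto simp: fin D intro!: measurable_prod_emb)
  have "\<omega> \<in> prod_emb UNIV ?M {0..<n} B"
    if \<omega>: "\<omega> \<in> space (fcfl V E D 1 S)" and late: "ereal_of_enat (convergence_time V E D \<omega>) \<ge> ereal T" for \<omega>
  proof -
    have sp: "\<omega> \<in> space (PiM UNIV ?M)"
      using \<omega> sets_eq_imp_space_eq[OF sets_fcfl[OF fin D]] by auto
    have "1 \<le> run_potential V E D S n \<omega>"
    proof (rule ccontr)
      assume "\<not> 1 \<le> run_potential V E D S n \<omega>"
      then have "consistent V E D (\<omega> (n - 1)) (fcfl_state V E D 1 S \<omega> n) \<and>
          card (unlocked V (fcfl_state V E D 1 S \<omega> n)) < 1"
        by (auto simp: run_potential_def potential_def not_le ennreal_of_nat_eq_real_of_nat split: if_splits)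
      moreover have "finite (unlocked V (fcfl_state V E D 1 S \<omega> n))"
        using fin by (simp add: unlocked_def)
      ultimately have "proper_colouring V E D (\<omega> (n - 1))"
        by (intro consistent_imp_proper_colouring) auto
      then have "convergence_time V E D \<omega> \<le> enat n"
        using n unfolding convergence_time_def by (intro Inf_lower) (auto intro!: exI[of _ "n - 1"])
      then have "ereal_of_enat (convergence_time V E D \<omega>) \<le> ereal_of_enat (enat n)"
        by (simp only: ereal_of_enat_le_iff)
      with late T show False
        by (metis ereal_less_eq(3) ereal_of_enat_simps(1) linorder_not_le order_trans)
    qed
    \<comment> \<open>As \<open>n > 0\<close>, the index \<open>n - 1\<close> lies below
      \<open>n\<close>, so the potential is a function of the first \<open>n\<close>
      entries.\<close>
    also have "run_potential V E D S n \<omega> = run_potential V E D S n (restrict \<omega> {0..<n})"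
      using n fcfl_state_cong[of n \<omega> "restrict \<omega> {0..<n}" V E D 1 S] by (simp add: run_potential_def)
    finally show ?thesis
      using sp by (auto simp: prod_emb_def B_def space_PiM PiE_iff)
  qed
  then have "?P \<le> prob (prod_emb UNIV ?M {0..<n} B)"
    by (intro finite_measure_mono emb) auto
  also have "\<dots> \<le> ?b"
  proof -
    have "ennreal (prob (prod_emb UNIV ?M {0..<n} B)) = emeasure (history V E D S n) B"
      by (simp only: emeasure_eq_measure[symmetric] emeasure_fcfl_cylinder[OF fin D B])
    also have "\<dots> = (\<integral>\<^sup>+\<omega>. indicator B \<omega> \<partial>history V E D S n)"
      using B by (simp add: sets_history[OF fin D])
    also have "\<dots> \<le> (\<integral>\<^sup>+\<omega>. run_potential V E D S n \<omega> \<partial>history V E D S n)"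
      by (intro nn_integral_mono) (auto simp: B_def split: split_indicator)
    also have "\<dots> \<le> ennreal ?b"
      by (rule nn_integral_run_potential[OF G D \<Delta>])
    finally show ?thesis
      by (subst (asm) ennreal_le_iff) (auto intro!: mult_nonneg_nonneg prod_nonneg)
  qed
  finally show ?thesis .
qed

section \<open>Periodic resets and the choice of constants\<close>

lemma prod_periodic_factor:
  fixes q :: real
  assumes "d > 0"
  shows "(\<Prod>t\<in>{1..n}. q * (if t \<in> (\<lambda>\<tau>. \<tau> * d) ` {1..} then 2 else 1)) = q ^ n * 2 ^ (n div d)"
proof (induction n)
  case (Suc n)
  \<comment> \<open>\<open>Suc n\<close> is positive, so a multiplier \<open>\<tau>\<close> with
    \<open>Suc n = \<tau> * d\<close> is automatically at least 1.\<close>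
  have "Suc n \<in> (\<lambda>\<tau>. \<tau> * d) ` {1..} \<longleftrightarrow> Suc n mod d = 0"
    using assms by (auto simp: image_iff mod_eq_0_iff_dvd dvd_def Suc_le_eq mult.commute)
      (metis gr0I mult_is_0 nat.distinct(1))
  with Suc show ?case by (simp add: div_Suc)
qed simp

text \<open>The horizon consists of \<open>\<tau>\<close> whole periods, each ending in its single
  reset, so the product of the slot factors collapses to a \<open>\<tau>\<close>-th power.\<close>

lemma prob_convergence_time_periodic_le:
  assumes G: "finite_graph V E" and \<Delta>: "max_degree V E > 0" and D: "D \<ge> max_degree V E + 1"
    and \<tau>: "\<tau> > 0" and T: "real (\<tau> * (max_degree V E + 1)) < T"
  shows "\<P>(\<omega> in fcfl V E D 1 (\<lambda>\<tau>. \<tau> * (max_degree V E + 1)).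
      ereal_of_enat (convergence_time V E D \<omega>) \<ge> ereal T) \<le> (2 / exp 1) ^ \<tau> * real (card V)"
    (is "?P \<le> _")
proof -
  let ?d = "max_degree V E + 1" and ?q = "real (max_degree V E) / real D"
  have "?q \<le> real (max_degree V E) / real ?d"
    using D by (intro divide_left_mono) auto
  also have "\<dots> = 1 - 1 / real ?d"
    by (simp add: field_simps)
  finally have "?q ^ ?d \<le> (1 - 1 / real ?d) ^ ?d"
    by (intro power_mono) auto
  also have "\<dots> \<le> exp (- 1)"
    by (rule exp_ge_one_minus_x_over_n_power_n) auto
  finally have "?q ^ ?d * 2 \<le> exp (- 1) * 2"
    by (rule mult_right_mono) simp
  then have q: "?q ^ ?d * 2 \<le> 2 / exp 1"
    by (simp add: exp_minus divide_inverse)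
  have "?P \<le> (\<Prod>t\<in>{1..\<tau> * ?d}. ?q * (if t \<in> (\<lambda>\<tau>. \<tau> * ?d) ` {1..} then 2 else 1)) * real (card V)"
    using \<tau> D by (intro prob_convergence_time_le G \<Delta> T) auto
  also have "\<dots> = (?q ^ ?d * 2) ^ \<tau> * real (card V)"
  proof -
    have "\<tau> * ?d div ?d = \<tau>" by (rule div_mult_self_is_m) simp
    moreover have "?q ^ (\<tau> * ?d) = (?q ^ ?d) ^ \<tau>" by (simp only: power_mult mult.commute[of \<tau>])
    ultimately show ?thesis by (simp only: prod_periodic_factor[of ?d] power_mult_distrib)
  qed
  also have "\<dots> \<le> (2 / exp 1) ^ \<tau> * real (card V)"
    by (intro mult_right_mono power_mono q) auto
  finally show ?thesis .
qed

theorem corollary4: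
  fixes \<beta>\<^sub>1 \<beta>\<^sub>2 \<epsilon> :: real
  assumes "0 < \<beta>\<^sub>1" and "\<beta>\<^sub>1 \<le> \<beta>\<^sub>2" and "0 < \<epsilon>" and "\<epsilon> < 1"
  shows "\<exists>C::real. C > 0 \<and> (\<exists>N\<^sub>0::nat. \<forall>(V :: 'v set) E D.
    finite_graph V E \<longrightarrow>
    card V \<ge> N\<^sub>0 \<longrightarrow>
    \<beta>\<^sub>1 * real (card V) \<le> real (max_degree V E) \<longrightarrow>
    real (max_degree V E) \<le> \<beta>\<^sub>2 * real (card V) \<longrightarrow>
    D \<ge> max_degree V E + 1 \<longrightarrow>
    \<P>(\<omega> in fcfl V E D 1 (\<lambda>\<tau>. \<tau> * (max_degree V E + 1)).
       ereal_of_enat (convergence_time V E D \<omega>) \<ge> ereal (C * real (card V) * ln (real (card V))))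
      \<le> \<epsilon>)"
proof -
  \<comment> \<open>\<open>a\<close> is the decay rate per period, as
    \<open>2 / exp 1 = exp (- a)\<close>. At most \<open>K * ln N\<close> periods are needed, each
    of at most \<open>(\<beta>\<^sub>2 + 1) * N\<close> slots; the last \<open>+ 1\<close> in
    \<open>C\<close> makes the horizon strictly smaller than \<open>C * N * ln N\<close>.\<close>
  define a where "a = 1 - ln (2 :: real)"
  define K where "K = (1 - ln \<epsilon>) / a + 1"
  define C where "C = K * (\<beta>\<^sub>2 + 1) + 1"
  have a: "a > 0" using ln_2_less_1 by (simp add: a_def)
  have \<epsilon>: "ln \<epsilon> < 0" using assms by simp
  have K: "K > 0" using a \<epsilon> by (simp add: K_def add_pos_pos)
  have C: "C > 0" using K assms by (simp add: C_def add_pos_pos)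
  have decay: "2 / exp 1 = exp (- a)" by (simp add: a_def exp_diff)
  have "\<P>(\<omega> in fcfl V E D 1 (\<lambda>\<tau>. \<tau> * (max_degree V E + 1)).
       ereal_of_enat (convergence_time V E D \<omega>) \<ge> ereal (C * real (card V) * ln (real (card V)))) \<le> \<epsilon>"
    if G: "finite_graph V E" and N: "card V \<ge> 3"
      and lower: "\<beta>\<^sub>1 * real (card V) \<le> real (max_degree V E)"
      and upper: "real (max_degree V E) \<le> \<beta>\<^sub>2 * real (card V)"
      and D: "D \<ge> max_degree V E + 1"
    for V :: "'v set" and E D
  proof -
    let ?N = "real (card V)"
    \<comment> \<open>The least number of periods with
      \<open>N * exp (- a * \<tau>) \<le> \<epsilon>\<close>.\<close>
    define \<tau> where "\<tau> = nat \<lceil>(ln ?N - ln \<epsilon>) / a\<rceil>"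
    have N3: "?N \<ge> 3" using N by simp
    \<comment> \<open>The threshold 3 is chosen to be at least \<open>exp 1\<close>, giving
      \<open>ln N \<ge> 1\<close>.\<close>
    have "exp 1 \<le> ?N" using exp_le N3 by linarith
    then have lnN: "ln ?N \<ge> 1" using N3 by (simp add: ln_ge_iff)
    have "0 < \<beta>\<^sub>1 * ?N" using assms N3 by (intro mult_pos_pos) auto
    with lower have \<Delta>: "max_degree V E > 0" by linarith
    have pos: "(ln ?N - ln \<epsilon>) / a > 0" using lnN \<epsilon> a by simp
    then have \<tau>: "\<tau> > 0" by (simp add: \<tau>_def)
    have "real \<tau> \<le> (ln ?N - ln \<epsilon>) / a + 1"
      using pos unfolding \<tau>_def by linarith
    \<comment> \<open>Both constants, \<open>- ln \<epsilon>\<close> and 1, are nonnegative and so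
      may be multiplied by \<open>ln N \<ge> 1\<close>.\<close>
    also have "\<dots> \<le> (ln ?N - ln \<epsilon> * ln ?N) / a + ln ?N"
      using lnN \<epsilon> a mult_left_mono_neg[of 1 "ln ?N" "ln \<epsilon>"] by (intro add_mono divide_right_mono) auto
    also have "\<dots> = K * ln ?N"
      by (simp add: K_def algebra_simps add_divide_distrib diff_divide_distrib)
    finally have \<tau>_le: "real \<tau> \<le> K * ln ?N" .
    have "real (\<tau> * (max_degree V E + 1)) = real \<tau> * (real (max_degree V E) + 1)"
      by (simp add: algebra_simps)
    also have "\<dots> \<le> (K * ln ?N) * ((\<beta>\<^sub>2 + 1) * ?N)"
      using upper N3 K lnN by (intro mult_mono \<tau>_le) (auto simp: algebra_simps)
    also have "\<dots> < C * ?N * ln ?N"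
      using N3 lnN by (simp add: C_def algebra_simps)
    finally have "\<P>(\<omega> in fcfl V E D 1 (\<lambda>\<tau>. \<tau> * (max_degree V E + 1)).
        ereal_of_enat (convergence_time V E D \<omega>) \<ge> ereal (C * ?N * ln ?N)) \<le> (2 / exp 1) ^ \<tau> * ?N"
      by (rule prob_convergence_time_periodic_le[OF G \<Delta> D \<tau>])
    also have "\<dots> = exp (ln ?N - a * real \<tau>)"
      using N3 by (simp add: decay exp_diff exp_minus field_simps flip: exp_of_nat_mult)
    also have "\<dots> \<le> exp (ln \<epsilon>)"
    proof -
      have "(ln ?N - ln \<epsilon>) / a \<le> real \<tau>" using pos unfolding \<tau>_def by linarith
      then show ?thesis using a by (simp add: field_simps)
    qed
    also have "\<dots> = \<epsilon>" using assms by simp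
    finally show ?thesis .
  qed
  then show ?thesis using C by blast
qed

end
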